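(* Let $w^\star(x,t)$ be the exact solution of the periodic advection problem $$w_t+\lambda w_x=0 \ \text{ on } [0,L]\times[0,T],\qquad w(0,t)=w(L,t)\ \text{ for } t\in[0,T],\qquad w(x,0)=w_0(x)\ \text{ for } x\in[0,L],$$ with $C^p$ initial condition in the sense that $w_0^{\mathrm{ext}}\in C^p(\mathbb{R})$, where $w_0^{\mathrm{ext}}$ is the $L$-periodic extension of $w_0$, and assume $p\ge 3$. For a positive integer $N$ (the number of cells) and $h=L/N$, let $w_j(t)$ and $\overline{w}_{j+1/2}(t)$ be the solutions of the semi-discretized hybrid-variable ODE system $$\overline{w}_{j+1/2}'+\frac{\lambda}{h}(w_{j+1}-w_j)=0,\qquad w_j'+\frac{\lambda}{h}\left(w_{j-1}-\frac72\overline{w}_{j-1/2}+2w_j+\frac12\overline{w}_{j+1/2}\right)=0,\qquad \forall j,\ t\in[0,T],$$ with exact initial data $$w_j(0)=w^\star(x_j,0),\qquad \overline{w}_{j+1/2}(0)=\frac1h\int_{x_j}^{x_{j+1}}w^\star(x,0)\,dx .$$ Then for any $\varepsilon_0>0$ there exists an $N_0>0$ that depends only on $L$, $T$, $\lambda$, $w^\star$, and $\varepsilon_0$, such that for all $N>N_0$ the corresponding semi-discretized solution satisfies $$|w_j(T)-w^\star(x_j,T)|\le \varepsilon_0\quad\text{and}\quad \left|\overline{w}_{j+1/2}(T)-\frac1h\int_{x_j}^{x_{j+1}}w^\star(x,T)\,dx\right|\le \varepsilon_0,\qquad\forall j .$$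
   Context: Here $L>0$, $T>0$, and $\lambda>0$ is a constant advection velocity. The interval $[0,L]$ is divided into $N$ uniform cells $[x_j,x_{j+1}]$, $0\le j\le N-1$, with $x_j=jh$ and $h=L/N$. The unknowns are the nodal values $w_j(t)$ and the cell-averaged values $\overline{w}_{j+1/2}(t)$, with the periodic index convention $w_j=w_{j+N}$ and $\overline{w}_{j+1/2}=\overline{w}_{j+N+1/2}$. *)

theory Defs
  imports "HOL-Analysis.Analysis"
begin

definition periodic_extension :: "real \<Rightarrow> (real \<Rightarrow> real) \<Rightarrow> real \<Rightarrow> real" where
  "periodic_extension L f x = f (x - L * of_int \<lfloor>x / L\<rfloor>)"

definition class_C :: "nat \<Rightarrow> (real \<Rightarrow> real) \<Rightarrow> bool" where
  "class_C p f \<longleftrightarrow>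
     (\<forall>k<p. (deriv ^^ k) f differentiable_on UNIV) \<and> continuous_on UNIV ((deriv ^^ p) f)"

(* Classical solution: u is (Frechet) differentiable on the closed rectangle, with one-sided
   derivatives on its boundary; ux and ut are the partial derivatives in x and t. *)
definition periodic_advection_solution ::
  "real \<Rightarrow> real \<Rightarrow> real \<Rightarrow> (real \<Rightarrow> real) \<Rightarrow> (real \<Rightarrow> real \<Rightarrow> real) \<Rightarrow> bool" where
  "periodic_advection_solution L T lam u0 u \<longleftrightarrow>
     (\<exists>ux ut. \<forall>x\<in>{0..L}. \<forall>t\<in>{0..T}.
        ((\<lambda>(y, s). u y s) has_derivative (\<lambda>(dx, dt). ux x t * dx + ut x t * dt))
          (at (x, t) within {0..L} \<times> {0..T}) \<and>
        ut x t + lam * ux x t = 0) \<and>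
     (\<forall>t\<in>{0..T}. u 0 t = u L t) \<and>
     (\<forall>x\<in>{0..L}. u x 0 = u0 x)"

definition node :: "real \<Rightarrow> nat \<Rightarrow> int \<Rightarrow> real" where
  "node L N j = of_int j * (L / real N)"

definition cell_average :: "real \<Rightarrow> nat \<Rightarrow> int \<Rightarrow> (real \<Rightarrow> real) \<Rightarrow> real" where
  "cell_average L N j f = 1 / (L / real N) * integral {node L N j..node L N (j + 1)} f"

(* w j is the nodal value at x_j and wbar j is the average over the cell [x_j, x_{j+1}], i.e. the
   unknown with index j + 1/2. Indices range over all integers and are N-periodic. *)
definition hybrid_variable_solution ::
  "real \<Rightarrow> real \<Rightarrow> real \<Rightarrow> nat \<Rightarrow> (int \<Rightarrow> real \<Rightarrow> real) \<Rightarrow> (int \<Rightarrow> real \<Rightarrow> real) \<Rightarrow> bool" where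
  "hybrid_variable_solution L T lam N w wbar \<longleftrightarrow>
     (let h = L / real N in
       \<forall>j. \<forall>t\<in>{0..T}.
         w (j + int N) t = w j t \<and> wbar (j + int N) t = wbar j t \<and>
         (\<exists>dwbar. (wbar j has_real_derivative dwbar) (at t within {0..T}) \<and>
            dwbar + lam / h * (w (j + 1) t - w j t) = 0) \<and>
         (\<exists>dw. (w j has_real_derivative dw) (at t within {0..T}) \<and>
            dw + lam / h * (w (j - 1) t - 7 / 2 * wbar (j - 1) t + 2 * w j t + 1 / 2 * wbar j t) = 0))"

definition exact_initial_data ::
  "real \<Rightarrow> nat \<Rightarrow> (real \<Rightarrow> real \<Rightarrow> real) \<Rightarrow> (int \<Rightarrow> real \<Rightarrow> real) \<Rightarrow> (int \<Rightarrow> real \<Rightarrow> real) \<Rightarrow> bool" where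
  "exact_initial_data L N u w wbar \<longleftrightarrow>
     (\<forall>j\<in>{0..<int N}. w j 0 = u (node L N j) 0 \<and> wbar j 0 = cell_average L N j (\<lambda>x. u x 0))"

end

theory Submission
  imports Defs
begin

text \<open>The proof follows the pattern ``consistency and stability imply convergence''. By the method of
  characteristics the exact solution is \<open>w\<^sup>*(x, t) = v (x - \<lambda> t)\<close>, where \<open>v\<close> is the periodic
  extension of the initial value (\<open>advection_solution_eq_translate\<close>). Inserted into the scheme, it
  satisfies the equations for the cell averages exactly and those for the nodal values up to a
  residual of size \<open>O(h)\<close> (\<open>nodal_stencil_consistency\<close>).

  The core is a stability estimate in the discrete \<open>L\<^sup>2\<close> norm that is uniform in \<open>h\<close>. Let \<open>e j\<close> and
  \<open>g j\<close> be the errors of the nodal value at \<open>x\<^sub>j\<close> and of the average over \<open>[x\<^sub>j, x\<^sub>j\<^sub>+\<^sub>1]\<close>. The energy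
  \[ E = \sum_j 9 g_j^2 + 6 e_j^2 - 4 e_j g_j - 8 g_{j-1} e_j \]
  dominates \<open>\<Sum>\<^sub>j (e j)\<^sup>2 + (g j)\<^sup>2\<close> (\<open>hybrid_energy_lower_bound\<close>), and along the homogeneous scheme it
  satisfies, by an algebraic identity up to telescoping terms,
  \[ E' = - \frac{\lambda}{h} \sum_j (2 e_{j-1} - 5 g_{j-1} + 4 e_j - g_j)^2 \le 0 . \]
  With a residual bounded by \<open>d\<close>, Gronwall's inequality gives \<open>E(T) = O(N d\<^sup>2)\<close>
  (\<open>hybrid_variable_stability\<close>). As \<open>d = O(h) = O(1/N)\<close>, the sum of the squares of all errors is
  \<open>O(1/N)\<close>; hence so is the square of each of them.\<close>

section \<open>Exact solution of the advection problem\<close>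

lemma periodic_extension_add_period:
  assumes "L > 0"
  shows "periodic_extension L f (x + L) = periodic_extension L f x"
proof -
  have "(x + L) / L = x / L + 1"
    using assms by (simp add: field_simps)
  then have "\<lfloor>(x + L) / L\<rfloor> = \<lfloor>x / L\<rfloor> + 1"
    by simp
  then show ?thesis
    by (simp add: periodic_extension_def algebra_simps)
qed

lemma periodic_extension_eq:
  assumes "L > 0" "f 0 = f L" "x \<in> {0..L}"
  shows "periodic_extension L f x = f x"
proof (cases "x = L")
  case True
  then show ?thesis
    using assms by (simp add: periodic_extension_def)
next
  case False
  then have "\<lfloor>x / L\<rfloor> = 0"
    using assms by (intro floor_unique) auto
  then show ?thesis
    by (simp add: periodic_extension_def)
qed

lemma advection_solution_constant_on_characteristic:
  assumes sol: "periodic_advection_solution L T lam u0 u"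
    and "lam > 0" "x \<in> {0..L}" "t \<in> {0..T}" "0 \<le> s" "s \<le> t" "0 \<le> x - lam * (t - s)"
  shows "u x t = u (x - lam * (t - s)) s"
proof -
  obtain ux ut where
    der: "\<And>y r. y \<in> {0..L} \<Longrightarrow> r \<in> {0..T} \<Longrightarrow>
        ((\<lambda>(y, s). u y s) has_derivative (\<lambda>(dx, dt). ux y r * dx + ut y r * dt))
          (at (y, r) within {0..L} \<times> {0..T})"
    and pde: "\<And>y r. y \<in> {0..L} \<Longrightarrow> r \<in> {0..T} \<Longrightarrow> ut y r + lam * ux y r = 0"
    using sol unfolding periodic_advection_solution_def by blast
  define c where "c r = (x - lam * (t - r), r)" for r
  have c_in: "c r \<in> {0..L} \<times> {0..T}" if "r \<in> {s..t}" for r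
  proof -
    have "lam * (t - r) \<le> lam * (t - s)" "0 \<le> lam * (t - r)"
      using that assms by auto
    then have "0 \<le> x - lam * (t - r)" "x - lam * (t - r) \<le> L"
      using assms(3,7) unfolding atLeastAtMost_iff by linarith+
    then show ?thesis
      using that assms(4,5) unfolding c_def by auto
  qed
  have "((\<lambda>r. (\<lambda>(y, s). u y s) (c r)) has_derivative (\<lambda>h. 0)) (at r within {s..t})"
    if r: "r \<in> {s..t}" for r
  proof -
    have 1: "(c has_derivative (\<lambda>h. (lam * h, h))) (at r within {s..t})"
      unfolding c_def by (auto intro!: derivative_eq_intros)
    have 2: "((\<lambda>(y, s). u y s) has_derivative
        (\<lambda>(dx, dt). ux (fst (c r)) r * dx + ut (fst (c r)) r * dt)) (at (c r) within c ` {s..t})"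
      using der[of "fst (c r)" r] c_in r
      by (auto simp: c_def intro!: has_derivative_subset[of _ _ _ "{0..L} \<times> {0..T}"])
    have 3: "(\<lambda>h. (\<lambda>(dx, dt). ux (fst (c r)) r * dx + ut (fst (c r)) r * dt) (lam * h, h)) = (\<lambda>h. 0)"
    proof
      fix h
      have "ux (fst (c r)) r * (lam * h) + ut (fst (c r)) r * h
          = h * (ut (fst (c r)) r + lam * ux (fst (c r)) r)"
        by (simp add: algebra_simps)
      also have "\<dots> = 0"
        using pde[of "fst (c r)" r] c_in[OF r] by (simp add: c_def)
      finally show "(\<lambda>(dx, dt). ux (fst (c r)) r * dx + ut (fst (c r)) r * dt) (lam * h, h) = 0"
        by simp
    qed
    show ?thesis
      using has_derivative_in_compose[OF 1 2] unfolding 3 .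
  qed
  then have "\<exists>k. \<forall>r\<in>{s..t}. (\<lambda>(y, s). u y s) (c r) = k"
    by (intro has_derivative_zero_constant) auto
  then have "(\<lambda>(y, s). u y s) (c t) = (\<lambda>(y, s). u y s) (c s)"
    using \<open>s \<le> t\<close> by auto
  then show ?thesis
    by (simp add: c_def)
qed

text \<open>Following a characteristic backwards in time, one either reaches the initial line or leaves
  through \<open>x = 0\<close> and re-enters at \<open>x = L\<close>; the induction counts the re-entries.\<close>

lemma advection_solution_eq_translate:
  assumes sol: "periodic_advection_solution L T lam u0 u"
    and "L > 0" "lam > 0" "x \<in> {0..L}" "t \<in> {0..T}"
  shows "u x t = periodic_extension L u0 (x - lam * t)"
proof -
  have bc: "u 0 s = u L s" if "s \<in> {0..T}" for s
    using sol that unfolding periodic_advection_solution_def by blast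
  have ic: "u y 0 = u0 y" if "y \<in> {0..L}" for y
    using sol that unfolding periodic_advection_solution_def by blast
  have u0: "u0 0 = u0 L"
    using bc[of 0] ic[of 0] ic[of L] assms by auto
  have init: "u y s = periodic_extension L u0 (y - lam * s)"
    if "y \<in> {0..L}" "s \<in> {0..T}" "0 \<le> y - lam * s" for y s
  proof -
    have "0 \<le> lam * s"
      using that assms(3) by simp
    then have "y - lam * s \<in> {0..L}"
      using that unfolding atLeastAtMost_iff by linarith
    moreover have "u y s = u (y - lam * s) 0"
      using advection_solution_constant_on_characteristic[OF sol \<open>lam > 0\<close> that(1,2), of 0] that
      by auto
    ultimately show ?thesis
      by (simp add: ic periodic_extension_eq[where f=u0, OF \<open>L > 0\<close> u0])
  qed
  have "u y s = periodic_extension L u0 (y - lam * s)"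
    if "y \<in> {0..L}" "s \<in> {0..T}" "- (real n * L) \<le> y - lam * s" for n y s
    using that
  proof (induction n arbitrary: y s)
    case 0
    then show ?case
      using init by simp
  next
    case (Suc n)
    show ?case
    proof (cases "0 \<le> y - lam * s")
      case True
      then show ?thesis
        using init Suc.prems by blast
    next
      case False
      \<comment> \<open>the time at which the characteristic through \<open>(y, s)\<close> enters at \<open>x = 0\<close>\<close>
      define r where "r = s - y / lam"
      have lr: "lam * (s - r) = y" "lam * r = lam * s - y" and r01: "0 \<le> r" "r \<le> s"
        using False Suc.prems \<open>lam > 0\<close> unfolding r_def by (auto simp: field_simps)
      then have r: "0 \<le> r" "r \<le> s" "r \<in> {0..T}"
        using Suc.prems by auto
      have "u y s = u 0 r"
        using advection_solution_constant_on_characteristic[OF sol \<open>lam > 0\<close> Suc.prems(1,2) r(1,2)] lr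
        by simp
      also have "\<dots> = u L r"
        using bc r by blast
      also have "\<dots> = periodic_extension L u0 (L - lam * r)"
        using Suc.prems lr r \<open>L > 0\<close> by (intro Suc.IH) (auto simp: algebra_simps)
      also have "L - lam * r = (y - lam * s) + L"
        using lr by simp
      finally show ?thesis
        by (simp only: periodic_extension_add_period[OF \<open>L > 0\<close>])
    qed
  qed
  moreover obtain n where "lam * t - x \<le> real n * L"
    using reals_Archimedean3[OF \<open>L > 0\<close>] less_imp_le by blast
  ultimately show ?thesis
    using assms by (auto simp: algebra_simps)
qed

section \<open>Consistency\<close>

lemma continuous_imp_ex_antiderivative:
  fixes f :: "real \<Rightarrow> real"
  assumes "continuous_on UNIV f"
  obtains F where "\<And>x. (F has_real_derivative f x) (at x)"
proof -
  have "isCont f x" for x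
    using assms by (simp add: continuous_on_eq_continuous_at)
  then have "\<exists>F. \<forall>x::real. - \<infinity> < ereal x \<longrightarrow> ereal x < \<infinity> \<longrightarrow> (F has_vector_derivative f x) (at x)"
    by (intro einterval_antiderivative) auto
  then show ?thesis
    using that by (auto simp: has_real_derivative_iff_has_vector_derivative)
qed

lemma class_C_derivatives:
  assumes "class_C p f" "p \<ge> 2"
  obtains f1 f2 where "\<And>x. (f has_real_derivative f1 x) (at x)"
    "\<And>x. (f1 has_real_derivative f2 x) (at x)" "continuous_on UNIV f2"
proof
  have diff: "(deriv ^^ k) f differentiable_on UNIV" if "k < p" for k
    using assms that by (simp add: class_C_def)
  have der: "((deriv ^^ k) f has_real_derivative (deriv ^^ Suc k) f x) (at x)" if "k < p" for k x
    using diff[OF that] by (simp add: differentiable_on_def DERIV_deriv_iff_real_differentiable)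
  show "(f has_real_derivative (deriv ^^ 1) f x) (at x)" for x
    using der[of 0 x] assms(2) by simp
  show "((deriv ^^ 1) f has_real_derivative (deriv ^^ 2) f x) (at x)" for x
    using der[of 1 x] assms(2) by (simp add: numeral_2_eq_2)
  show "continuous_on UNIV ((deriv ^^ 2) f)"
  proof (cases "p = 2")
    case True
    then show ?thesis
      using assms by (simp add: class_C_def)
  next
    case False
    then show ?thesis
      using assms diff[of 2] by (intro differentiable_imp_continuous_on) auto
  qed
qed

text \<open>The bracket of the nodal equation, applied to a function \<open>v\<close> and to its cell averages, equals
  \<open>h v' + O(h\<^sup>2)\<close>. Here \<open>V\<close> is an antiderivative of \<open>v\<close>, so that the averages are its divided
  differences. For polynomials of degree at most three the bracket even
  equals \<open>h v'\<close>, but the cruder bound suffices for convergence.\<close>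

lemma nodal_stencil_consistency:
  fixes V v v1 v2 :: "real \<Rightarrow> real"
  assumes V: "\<And>x. (V has_real_derivative v x) (at x)"
    and v: "\<And>x. (v has_real_derivative v1 x) (at x)"
    and v1: "\<And>x. (v1 has_real_derivative v2 x) (at x)"
    and B: "\<And>s. s \<in> {y - h..y + h} \<Longrightarrow> \<bar>v2 s\<bar> \<le> B"
    and "h > 0"
  shows "\<bar>v (y - h) - 7 / 2 * ((V y - V (y - h)) / h) + 2 * v y + 1 / 2 * ((V (y + h) - V y) / h)
           - h * v1 y\<bar> \<le> 2 * B * h\<^sup>2"
proof -
  define D where "D m = [V, v, v1, v2] ! m" for m
  have D0: "D 0 = V"
    by (simp add: D_def)
  have D: "\<forall>m t. m < 3 \<and> a \<le> t \<and> t \<le> b \<longrightarrow> (D m has_real_derivative D (Suc m) t) (at t)" for a b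
    using V v v1 by (auto simp: D_def less_Suc_eq numeral_3_eq_3)
  define D' where "D' m = [v, v1, v2] ! m" for m
  have D0': "D' 0 = v"
    by (simp add: D'_def)
  have D': "\<forall>m t. m < 2 \<and> a \<le> t \<and> t \<le> b \<longrightarrow> (D' m has_real_derivative D' (Suc m) t) (at t)" for a b
    using v v1 by (auto simp: D'_def less_Suc_eq numeral_2_eq_2)
  obtain s1 where s1: "s1 > y" "s1 < y + h"
    and "V (y + h) = (\<Sum>m<3. D m y / fact m * (y + h - y) ^ m) + D 3 s1 / fact 3 * (y + h - y) ^ 3"
    using Taylor_up[of 3 D V y "y + h" y, OF _ D0 D] \<open>h > 0\<close> by auto
  then have V1: "V (y + h) = V y + h * v y + h\<^sup>2 / 2 * v1 y + h ^ 3 / 6 * v2 s1"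
    by (simp add: D_def numeral_eq_Suc fact_numeral algebra_simps)
  obtain s2 where s2: "s2 > y - h" "s2 < y"
    and "V (y - h) = (\<Sum>m<3. D m y / fact m * (y - h - y) ^ m) + D 3 s2 / fact 3 * (y - h - y) ^ 3"
    using Taylor_down[of 3 D V "y - h" y y, OF _ D0 D] \<open>h > 0\<close> by auto
  then have V2: "V (y - h) = V y - h * v y + h\<^sup>2 / 2 * v1 y - h ^ 3 / 6 * v2 s2"
    by (simp add: D_def numeral_eq_Suc fact_numeral algebra_simps)
  obtain s3 where s3: "s3 > y - h" "s3 < y"
    and "v (y - h) = (\<Sum>m<2. D' m y / fact m * (y - h - y) ^ m) + D' 2 s3 / fact 2 * (y - h - y) ^ 2"
    using Taylor_down[of 2 D' v "y - h" y y, OF _ D0' D'] \<open>h > 0\<close> by auto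
  then have v3: "v (y - h) = v y - h * v1 y + h\<^sup>2 / 2 * v2 s3"
    by (simp add: D'_def numeral_eq_Suc fact_numeral algebra_simps)
  have "v (y - h) - 7 / 2 * ((V y - V (y - h)) / h) + 2 * v y + 1 / 2 * ((V (y + h) - V y) / h) - h * v1 y
      = h\<^sup>2 * (v2 s3 / 2 - 7 / 12 * v2 s2 + v2 s1 / 12)"
    unfolding V1 V2 v3 using \<open>h > 0\<close> by (simp add: field_simps power2_eq_square power3_eq_cube)
  moreover have "h\<^sup>2 * \<bar>v2 s3 / 2 - 7 / 12 * v2 s2 + v2 s1 / 12\<bar> \<le> h\<^sup>2 * (2 * B)"
    using B[of s1] B[of s2] B[of s3] s1 s2 s3 by (intro mult_left_mono) auto
  ultimately show ?thesis
    by (simp add: abs_mult mult.commute)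
qed

section \<open>Energy stability\<close>

lemma sum_periodic_shift:
  fixes f :: "int \<Rightarrow> 'a::ab_group_add"
  assumes "f (int N) = f 0"
  shows "(\<Sum>j\<in>{0..<int N}. f (j + 1)) = (\<Sum>j\<in>{0..<int N}. f j)"
proof (cases "N = 0")
  case False
  have "(\<Sum>j\<in>{0..<int N}. f (j + 1)) = (\<Sum>j\<in>{1..<int N + 1}. f j)"
    by (rule sum.reindex_bij_witness[of _ "\<lambda>j. j - 1" "\<lambda>j. j + 1"]) auto
  also have "{1..<int N + 1} = insert (int N) {1..<int N}"
    using False by auto
  also have "(\<Sum>j\<in>\<dots>. f j) = f 0 + (\<Sum>j\<in>{1..<int N}. f j)"
    using assms by simp
  also have "\<dots> = (\<Sum>j\<in>insert 0 {1..<int N}. f j)"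
    by simp
  also have "insert 0 {1..<int N} = {0..<int N}"
    using False by auto
  finally show ?thesis .
qed simp

text \<open>The energy of nodal values \<open>e\<close> and cell averages \<open>g\<close>, where \<open>g j\<close> belongs to the cell
  \<open>[x\<^sub>j, x\<^sub>j\<^sub>+\<^sub>1]\<close>, so that \<open>g (j - 1)\<close> and \<open>g j\<close> are the averages to the left and to the right of
  \<open>x\<^sub>j\<close>. The unsymmetric mixed terms are what makes the dissipation of the scheme a single square.\<close>

definition hybrid_energy :: "nat \<Rightarrow> (int \<Rightarrow> real) \<Rightarrow> (int \<Rightarrow> real) \<Rightarrow> real" where
  "hybrid_energy N e g =
     (\<Sum>j\<in>{0..<int N}. 9 * (g j)\<^sup>2 + 6 * (e j)\<^sup>2 - 4 * (e j * g j) - 8 * (g (j - 1) * e j))"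

lemma hybrid_energy_lower_bound:
  assumes "\<And>j. g (j + int N) = g j"
  shows "(\<Sum>j\<in>{0..<int N}. (e j)\<^sup>2 + (g j)\<^sup>2) \<le> hybrid_energy N e g"
proof -
  \<comment> \<open>Shifting \<open>24 / 5\<close> of the weight of each \<open>(g j)\<^sup>2\<close> to the neighbouring summand balances the
    two mixed terms.\<close>
  have *: "x\<^sup>2 + d\<^sup>2 + 24 / 5 * (d\<^sup>2 - b\<^sup>2) \<le> 9 * d\<^sup>2 + 6 * x\<^sup>2 - 4 * (x * d) - 8 * (b * x)" for x d b :: real
  proof -
    have "9 * d\<^sup>2 + 6 * x\<^sup>2 - 4 * (x * d) - 8 * (b * x) - (x\<^sup>2 + d\<^sup>2 + 24 / 5 * (d\<^sup>2 - b\<^sup>2))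
        = 4 / 5 * d\<^sup>2 + 12 / 5 * (d - 5 / 6 * x)\<^sup>2 + 24 / 5 * (b - 5 / 6 * x)\<^sup>2"
      by (simp add: power2_eq_square field_simps)
    also have "\<dots> \<ge> 0"
      by simp
    finally show ?thesis
      by linarith
  qed
  have "(\<Sum>j\<in>{0..<int N}. (g j)\<^sup>2 - (g (j - 1))\<^sup>2) = 0"
    using sum_periodic_shift[of "\<lambda>j. (g (j - 1))\<^sup>2" N] assms[of "- 1"]
    by (simp add: sum_subtractf algebra_simps)
  then have "(\<Sum>j\<in>{0..<int N}. 24 / 5 * ((g j)\<^sup>2 - (g (j - 1))\<^sup>2)) = 0"
    by (simp only: sum_distrib_left[symmetric] mult_zero_right)
  then have "(\<Sum>j\<in>{0..<int N}. (e j)\<^sup>2 + (g j)\<^sup>2)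
      = (\<Sum>j\<in>{0..<int N}. (e j)\<^sup>2 + (g j)\<^sup>2 + 24 / 5 * ((g j)\<^sup>2 - (g (j - 1))\<^sup>2))"
    by (simp only: sum.distrib add_0_right)
  also have "\<dots> \<le> hybrid_energy N e g"
    unfolding hybrid_energy_def by (intro sum_mono *)
  finally show ?thesis .
qed

text \<open>The left-hand side of the conclusion is the time derivative of the energy when \<open>e'\<close> and \<open>g'\<close>
  are the time derivatives of \<open>e\<close> and \<open>g\<close>, given by the scheme with the residual \<open>r\<close> in the nodal
  equations. The square that is subtracted is that of
  \[ 2 (e_{j-1} - 2 g_{j-1} + e_j) - (g_{j-1} - 2 e_j + g_j) , \]
  a combination of two second differences on the grid of half cells.\<close>

lemma hybrid_energy_production_bound:
  fixes e g e' g' r :: "int \<Rightarrow> real"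
  assumes per: "\<And>j. e (j + int N) = e j" "\<And>j. g (j + int N) = g j"
    and g': "\<And>j. g' j = - c * (e (j + 1) - e j)"
    and e': "\<And>j. e' j = - c * (e (j - 1) - 7 / 2 * g (j - 1) + 2 * e j + 1 / 2 * g j) + r j"
    and r: "\<And>j. j \<in> {0..<int N} \<Longrightarrow> \<bar>r j\<bar> \<le> d"
    and "c \<ge> 0"
  shows "(\<Sum>j\<in>{0..<int N}. 18 * g j * g' j + 12 * e j * e' j - 4 * (e' j * g j + e j * g' j)
            - 8 * (g' (j - 1) * e j + g (j - 1) * e' j))
          \<le> 12 * real N * d\<^sup>2 + 6 * hybrid_energy N e g" (is "(\<Sum>j\<in>_. ?P j) \<le> _")
proof -
  define flux where "flux j = 12 * (e (j - 1) * g (j - 1)) - 18 * (g (j - 1) * e j)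
    + 4 * (e (j - 1) * e j) - 4 * (e (j - 1))\<^sup>2 + 3 * (g (j - 1))\<^sup>2" for j
  have g'': "g' (j - 1) = - c * (e j - e (j - 1))" for j
    using g'[of "j - 1"] by simp
  have P: "?P j = c * (flux (j + 1) - flux j)
      - c * (2 * e (j - 1) - 5 * g (j - 1) + 4 * e j - g j)\<^sup>2
      + r j * (12 * e j - 4 * g j - 8 * g (j - 1))" for j
    unfolding g' g'' e' flux_def by (simp add: power2_eq_square field_simps)
  have forcing: "r j * (12 * e j - 4 * g j - 8 * g (j - 1))
      \<le> 12 * d\<^sup>2 + (6 * ((e j)\<^sup>2 + (g j)\<^sup>2) + 4 * ((g (j - 1))\<^sup>2 - (g j)\<^sup>2))"
    if "j \<in> {0..<int N}" for j
  proof -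
    have "12 * (r j)\<^sup>2 + (6 * ((e j)\<^sup>2 + (g j)\<^sup>2) + 4 * ((g (j - 1))\<^sup>2 - (g j)\<^sup>2))
        - r j * (12 * e j - 4 * g j - 8 * g (j - 1))
        = 6 * (e j - r j)\<^sup>2 + 2 * (g j + r j)\<^sup>2 + 4 * (g (j - 1) + r j)\<^sup>2"
      by (simp add: power2_eq_square algebra_simps)
    also have "\<dots> \<ge> 0"
      by simp
    finally have "r j * (12 * e j - 4 * g j - 8 * g (j - 1))
        \<le> 12 * (r j)\<^sup>2 + (6 * ((e j)\<^sup>2 + (g j)\<^sup>2) + 4 * ((g (j - 1))\<^sup>2 - (g j)\<^sup>2))"
      by simp
    moreover have "(r j)\<^sup>2 \<le> d\<^sup>2"
      using r[OF that] by (simp add: abs_le_square_iff[symmetric])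
    ultimately show ?thesis
      by simp
  qed
  have "(\<Sum>j\<in>{0..<int N}. flux (j + 1)) = (\<Sum>j\<in>{0..<int N}. flux j)"
    using per(1)[of "- 1"] per(1)[of 0] per(2)[of "- 1"]
    by (intro sum_periodic_shift) (simp add: flux_def algebra_simps)
  then have flux0: "(\<Sum>j\<in>{0..<int N}. c * (flux (j + 1) - flux j)) = 0"
    by (simp add: sum_subtractf flip: sum_distrib_left)
  have g0: "(\<Sum>j\<in>{0..<int N}. 4 * ((g (j - 1))\<^sup>2 - (g j)\<^sup>2)) = 0"
    using sum_periodic_shift[of "\<lambda>j. (g (j - 1))\<^sup>2" N] per(2)[of "- 1"]
    by (simp add: sum_subtractf algebra_simps flip: sum_distrib_left)
  have "(\<Sum>j\<in>{0..<int N}. ?P j) \<le> (\<Sum>j\<in>{0..<int N}. c * (flux (j + 1) - flux j)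
      + (12 * d\<^sup>2 + (6 * ((e j)\<^sup>2 + (g j)\<^sup>2) + 4 * ((g (j - 1))\<^sup>2 - (g j)\<^sup>2))))"
  proof (rule sum_mono)
    fix j assume "j \<in> {0..<int N}"
    moreover have "0 \<le> c * (2 * e (j - 1) - 5 * g (j - 1) + 4 * e j - g j)\<^sup>2"
      using \<open>c \<ge> 0\<close> by simp
    ultimately show "?P j \<le> c * (flux (j + 1) - flux j)
      + (12 * d\<^sup>2 + (6 * ((e j)\<^sup>2 + (g j)\<^sup>2) + 4 * ((g (j - 1))\<^sup>2 - (g j)\<^sup>2)))"
      unfolding P using forcing[of j] by linarith
  qed
  also have "\<dots> = 12 * real N * d\<^sup>2 + 6 * (\<Sum>j\<in>{0..<int N}. (e j)\<^sup>2 + (g j)\<^sup>2)"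
    unfolding sum.distrib[of _ _ "{0..<int N}"] flux0 g0
    by (simp add: sum.distrib flip: sum_distrib_left)
  also have "\<dots> \<le> 12 * real N * d\<^sup>2 + 6 * hybrid_energy N e g"
    using hybrid_energy_lower_bound[of g N e] per by simp
  finally show ?thesis .
qed

lemma gronwall_linear:
  fixes E E' :: "real \<Rightarrow> real"
  assumes der: "\<And>t. t \<in> {0..T} \<Longrightarrow> (E has_real_derivative E' t) (at t within {0..T})"
    and E': "\<And>t. t \<in> {0..T} \<Longrightarrow> E' t \<le> a + k * E t"
    and "E 0 = 0" "T \<ge> 0" "a \<ge> 0" "k \<ge> 0"
  shows "E T \<le> a * T * exp (k * T)"
proof -
  define G where "G t = E t * exp (- k * t) - a * t" for t
  have G: "(G has_real_derivative (E' t - k * E t) * exp (- k * t) - a) (at t within {0..T})"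
    if "t \<in> {0..T}" for t
    unfolding G_def using der[OF that] by (auto intro!: derivative_eq_intros simp: algebra_simps)
  have "G T \<le> G 0"
  proof (rule DERIV_nonpos_imp_decreasing_open[OF \<open>T \<ge> 0\<close>])
    show "continuous_on {0..T} G"
      using G by (intro DERIV_continuous_on)
    fix t assume t: "0 < t" "t < T"
    then have "at t within {0..T} = at t"
      by (intro at_within_Icc_at) auto
    moreover have "E' t - k * E t \<le> a"
      using E'[of t] t by simp
    then have "(E' t - k * E t) * exp (- k * t) \<le> a * 1"
      using t \<open>a \<ge> 0\<close> \<open>k \<ge> 0\<close> by (intro mult_mono) auto
    ultimately show "\<exists>y. (G has_real_derivative y) (at t) \<and> y \<le> 0"
      using G[of t] t by (intro exI[of _ "(E' t - k * E t) * exp (- k * t) - a"]) auto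
  qed
  then have "E T * exp (- k * T) \<le> a * T"
    using \<open>E 0 = 0\<close> by (simp add: G_def)
  then show ?thesis
    by (simp add: exp_minus field_simps)
qed

text \<open>The bound does not depend on the size of \<open>c = \<lambda> / h\<close>, which tends to infinity as the grid is
  refined.\<close>

lemma hybrid_variable_stability:
  fixes e g r :: "int \<Rightarrow> real \<Rightarrow> real"
  assumes per: "\<And>j t. t \<in> {0..T} \<Longrightarrow> e (j + int N) t = e j t"
      "\<And>j t. t \<in> {0..T} \<Longrightarrow> g (j + int N) t = g j t"
    and g': "\<And>j t. t \<in> {0..T} \<Longrightarrow>
      (g j has_real_derivative - c * (e (j + 1) t - e j t)) (at t within {0..T})"
    and e': "\<And>j t. t \<in> {0..T} \<Longrightarrow>
      (e j has_real_derivative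
        - c * (e (j - 1) t - 7 / 2 * g (j - 1) t + 2 * e j t + 1 / 2 * g j t) + r j t)
        (at t within {0..T})"
    and r: "\<And>j t. j \<in> {0..<int N} \<Longrightarrow> t \<in> {0..T} \<Longrightarrow> \<bar>r j t\<bar> \<le> d"
    and init: "\<And>j. e j 0 = 0" "\<And>j. g j 0 = 0"
    and "c \<ge> 0" "T \<ge> 0"
  shows "(\<Sum>j\<in>{0..<int N}. (e j T)\<^sup>2 + (g j T)\<^sup>2) \<le> 12 * real N * d\<^sup>2 * T * exp (6 * T)"
proof -
  define E where "E t = hybrid_energy N (\<lambda>j. e j t) (\<lambda>j. g j t)" for t
  define g1 where "g1 j t = - c * (e (j + 1) t - e j t)" for j t
  define e1 where
    "e1 j t = - c * (e (j - 1) t - 7 / 2 * g (j - 1) t + 2 * e j t + 1 / 2 * g j t) + r j t" for j t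
  define E' where "E' t = (\<Sum>j\<in>{0..<int N}. 18 * g j t * g1 j t + 12 * e j t * e1 j t
      - 4 * (e1 j t * g j t + e j t * g1 j t)
      - 8 * (g1 (j - 1) t * e j t + g (j - 1) t * e1 j t))" for t
  have "E T \<le> 12 * real N * d\<^sup>2 * T * exp (6 * T)"
  proof (rule gronwall_linear[where E' = E'])
    fix t assume t: "t \<in> {0..T}"
    note [derivative_intros] = g'[OF t, folded g1_def] e'[OF t, folded e1_def]
    show "(E has_real_derivative E' t) (at t within {0..T})"
      unfolding E_def E'_def hybrid_energy_def
      by (intro DERIV_sum) (auto intro!: derivative_eq_intros simp: algebra_simps)
    show "E' t \<le> 12 * real N * d\<^sup>2 + 6 * E t"
      unfolding E_def E'_def using t r per \<open>c \<ge> 0\<close>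
      by (intro hybrid_energy_production_bound[where c = c and r = "\<lambda>j. r j t"])
        (auto simp: g1_def e1_def)
  next
    show "E 0 = 0"
      by (simp add: E_def hybrid_energy_def init)
  qed (use \<open>T \<ge> 0\<close> in auto)
  moreover have "(\<Sum>j\<in>{0..<int N}. (e j T)\<^sup>2 + (g j T)\<^sup>2) \<le> E T"
    unfolding E_def using per(2)[of T] \<open>T \<ge> 0\<close> by (intro hybrid_energy_lower_bound) auto
  ultimately show ?thesis
    by simp
qed

section \<open>Convergence\<close>

lemma periodic_eq_on_period:
  fixes f :: "int \<Rightarrow> 'a"
  assumes per: "\<And>j. f (j + int N) = f j" and "N > 0"
    and "\<And>j. j \<in> {0..<int N} \<Longrightarrow> f j = a"
  shows "f j = a"
proof -
  have shift: "f (i + int n * int N) = f i" for i n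
  proof (induction n)
    case (Suc n)
    then show ?case
      using per[of "i + int n * int N"] by (simp add: algebra_simps)
  qed simp
  have "f (j mod int N) = f j"
  proof (cases "j div int N \<ge> 0")
    case True
    then have "int (nat (j div int N)) = j div int N" by simp
    then show ?thesis
      using shift[of "j mod int N" "nat (j div int N)"] by simp
  next
    case False
    then have "int (nat (- (j div int N))) = - (j div int N)" by simp
    then show ?thesis
      using shift[of j "nat (- (j div int N))"] by (simp add: minus_div_mult_eq_mod)
  qed
  moreover have "f (j mod int N) = a"
    using assms by simp
  ultimately show ?thesis
    by simp
qed

theorem theorem3p5:
  fixes L T lam eps0 :: real and p :: nat
    and w0 :: "real \<Rightarrow> real" and wstar :: "real \<Rightarrow> real \<Rightarrow> real"
  assumes "L > 0" and "T > 0" and "lam > 0"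
    and "p \<ge> 3" and "class_C p (periodic_extension L w0)"
    and "periodic_advection_solution L T lam w0 wstar"
    and "eps0 > 0"
  shows "\<exists>N0::nat. N0 > 0 \<and>
    (\<forall>N>N0. \<forall>w wbar.
      hybrid_variable_solution L T lam N w wbar \<longrightarrow>
      exact_initial_data L N wstar w wbar \<longrightarrow>
      (\<forall>j\<in>{0..<int N}.
        \<bar>w j T - wstar (node L N j) T\<bar> \<le> eps0 \<and>
        \<bar>wbar j T - cell_average L N j (\<lambda>x. wstar x T)\<bar> \<le> eps0))"
proof -
  define v where "v = periodic_extension L w0"
  have "class_C p v" "p \<ge> 2"
    using assms(4,5) by (simp_all add: v_def)
  then obtain v1 v2 where v1: "\<And>x. (v has_real_derivative v1 x) (at x)"
    and v2: "\<And>x. (v1 has_real_derivative v2 x) (at x)" and "continuous_on UNIV v2"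
    using class_C_derivatives by blast
  have "continuous_on UNIV v"
    using v1 by (meson DERIV_isCont continuous_at_imp_continuous_on)
  then obtain V where V: "\<And>x. (V has_real_derivative v x) (at x)"
    using continuous_imp_ex_antiderivative by blast
  have exact: "wstar x t = v (x - lam * t)" if "x \<in> {0..L}" "t \<in> {0..T}" for x t
    unfolding v_def using advection_solution_eq_translate assms that by blast
  have v_per: "v (x + L) = v x" for x
    unfolding v_def using \<open>L > 0\<close> by (rule periodic_extension_add_period)
  have V_per: "V (x + L) - V x = V (y + L) - V y" for x y
  proof (rule DERIV_isconst_all[of "\<lambda>x. V (x + L) - V x"], rule allI)
    fix x
    have "((\<lambda>x. V (x + L)) has_real_derivative v (x + L)) (at x)"
      using V[of "x + L"] by (simp add: DERIV_shift)
    from DERIV_diff[OF this V[of x]] show "((\<lambda>x. V (x + L) - V x) has_real_derivative 0) (at x)"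
      by (simp add: v_per)
  qed
  have "bounded (v2 ` {- lam * T - L..2 * L})"
    using continuous_on_subset[OF \<open>continuous_on UNIV v2\<close> subset_UNIV]
    by (intro compact_imp_bounded compact_continuous_image) auto
  then obtain B where B: "\<forall>s\<in>{- lam * T - L..2 * L}. \<bar>v2 s\<bar> \<le> B"
    by (auto simp: bounded_iff simp del: atLeastAtMost_iff)
  define K where "K = 48 * (lam * B * L)\<^sup>2 * T * exp (6 * T)"
  \<comment> \<open>The sum of the squared errors at time \<open>T\<close> will be at most \<open>K / N\<close>.\<close>
  obtain N0 :: nat where N0: "max (K / eps0\<^sup>2) 0 < real N0"
    using reals_Archimedean2 by blast
  show ?thesis
  proof (intro exI[of _ N0] conjI allI impI)
    show "N0 > 0"
      using N0 by simp
    fix N w wbar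
    assume "N > N0" and sol: "hybrid_variable_solution L T lam N w wbar"
      and init: "exact_initial_data L N wstar w wbar"
    then have "N > 0"
      by simp
    define h where "h = L / real N"
    have h: "h > 0" "h \<le> L" "real N * h = L"
      using \<open>L > 0\<close> \<open>N > 0\<close> by (auto simp: h_def field_simps)
    have node_eq: "node L N j = of_int j * h" for j
      by (simp add: node_def h_def)
    have node_Suc: "node L N (j + 1) = node L N j + h" "node L N (j - 1) = node L N j - h" for j
      by (simp_all add: node_eq algebra_simps)
    have node_per: "node L N (j + int N) = node L N j + L" for j
      using h by (simp add: node_eq algebra_simps)
    have node_in: "node L N j \<in> {0..L}" "node L N (j + 1) \<in> {0..L}" if "j \<in> {0..<int N}" for j
    proof -
      have "of_int j * h \<ge> 0" "of_int (j + 1) * h \<le> real N * h"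
        using that h by (auto intro!: mult_right_mono)
      then show "node L N j \<in> {0..L}" "node L N (j + 1) \<in> {0..L}"
        using h unfolding node_eq by (auto simp: algebra_simps)
    qed
    \<comment> \<open>the nodal values and the cell averages of the exact solution, for all integer indices\<close>
    define W where "W j t = v (node L N j - lam * t)" for j t
    define Wbar where
      "Wbar j t = (V (node L N j - lam * t + h) - V (node L N j - lam * t)) / h" for j t
    have Wbar: "cell_average L N j (\<lambda>x. wstar x t) = Wbar j t"
      if j: "j \<in> {0..<int N}" and t: "t \<in> {0..T}" for j t
    proof -
      have "((\<lambda>x. v (x - lam * t)) has_integral
          V (node L N (j + 1) - lam * t) - V (node L N j - lam * t)) {node L N j..node L N (j + 1)}"
        using h by (intro fundamental_theorem_of_calculus)
          (auto intro!: derivative_eq_intros DERIV_chain2[OF V, THEN DERIV_cong] simp: node_Suc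
            simp flip: has_real_derivative_iff_has_vector_derivative)
      then have "((\<lambda>x. wstar x t) has_integral
          V (node L N (j + 1) - lam * t) - V (node L N j - lam * t)) {node L N j..node L N (j + 1)}"
        by (rule has_integral_eq[rotated]) (use exact[OF _ t] node_in[OF j] in auto)
      then have "integral {node L N j..node L N (j + 1)} (\<lambda>x. wstar x t)
          = V (node L N j - lam * t + h) - V (node L N j - lam * t)"
        by (simp add: integral_unique node_Suc(1) add_diff_eq diff_add_eq)
      then show ?thesis
        by (simp add: cell_average_def Wbar_def h_def)
    qed
    define c where "c = lam / h"
    have "c \<ge> 0"
      using \<open>lam > 0\<close> h by (simp add: c_def)
    have sol': "w (j + int N) t = w j t \<and> wbar (j + int N) t = wbar j t \<and>
        (\<exists>D. (wbar j has_real_derivative D) (at t within {0..T}) \<and>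
          D + c * (w (j + 1) t - w j t) = 0) \<and>
        (\<exists>D. (w j has_real_derivative D) (at t within {0..T}) \<and>
          D + c * (w (j - 1) t - 7 / 2 * wbar (j - 1) t + 2 * w j t + 1 / 2 * wbar j t) = 0)"
      if "t \<in> {0..T}" for j t
      using sol[unfolded hybrid_variable_solution_def Let_def, folded h_def c_def,
          THEN spec, THEN bspec, OF that] .
    have per: "w (j + int N) t = w j t" "wbar (j + int N) t = wbar j t" if "t \<in> {0..T}" for j t
      using sol'[OF that, of j] by simp_all
    have wbar': "(wbar j has_real_derivative - c * (w (j + 1) t - w j t)) (at t within {0..T})"
      if "t \<in> {0..T}" for j t
      using sol'[OF that, of j] by (auto simp: add_eq_0_iff2)
    have w': "(w j has_real_derivative
        - c * (w (j - 1) t - 7 / 2 * wbar (j - 1) t + 2 * w j t + 1 / 2 * wbar j t))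
        (at t within {0..T})"
      if "t \<in> {0..T}" for j t
      using sol'[OF that, of j] by (auto simp: add_eq_0_iff2)
    have W': "(W j has_real_derivative - lam * v1 (node L N j - lam * t)) (at t within S)" for j t S
      unfolding W_def by (auto intro!: derivative_eq_intros DERIV_chain2[OF v1, THEN DERIV_cong])
    have Wbar': "(Wbar j has_real_derivative - c * (W (j + 1) t - W j t)) (at t within S)" for j t S
      unfolding Wbar_def W_def node_Suc c_def using h
      by (auto intro!: derivative_eq_intros DERIV_chain2[OF V, THEN DERIV_cong] simp: field_simps)
    define e where "e j t = w j t - W j t" for j t
    define g where "g j t = wbar j t - Wbar j t" for j t
    \<comment> \<open>the residual of the exact solution in the nodal equations\<close>
    define r where "r j t = - c * (W (j - 1) t - 7 / 2 * Wbar (j - 1) t + 2 * W j t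
      + 1 / 2 * Wbar j t - h * v1 (node L N j - lam * t))" for j t
    have W_per: "W (j + int N) t = W j t" for j t
      using v_per[of "node L N j - lam * t"] by (simp add: W_def node_per algebra_simps)
    have Wbar_per: "Wbar (j + int N) t = Wbar j t" for j t
      using V_per[of "node L N j - lam * t + h" "node L N j - lam * t"]
      by (simp add: Wbar_def node_per algebra_simps)
    have e_per: "e (j + int N) t = e j t" "g (j + int N) t = g j t" if "t \<in> {0..T}" for j t
      using per[OF that] by (simp_all add: e_def g_def W_per Wbar_per)
    have r_le: "\<bar>r j t\<bar> \<le> 2 * lam * B * h" if "j \<in> {0..<int N}" "t \<in> {0..T}" for j t
    proof -
      define y where "y = node L N j - lam * t"
      have "0 \<le> lam * t" "lam * t \<le> lam * T"
        using that \<open>lam > 0\<close> by auto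
      then have "{y - h..y + h} \<subseteq> {- lam * T - L..2 * L}"
        using node_in(1)[OF that(1)] h unfolding y_def by auto
      then have "\<bar>v (y - h) - 7 / 2 * ((V y - V (y - h)) / h) + 2 * v y
          + 1 / 2 * ((V (y + h) - V y) / h) - h * v1 y\<bar> \<le> 2 * B * h\<^sup>2"
        using B h by (intro nodal_stencil_consistency[OF V v1 v2]) auto
      then have "\<bar>W (j - 1) t - 7 / 2 * Wbar (j - 1) t + 2 * W j t + 1 / 2 * Wbar j t
          - h * v1 (node L N j - lam * t)\<bar> \<le> 2 * B * h\<^sup>2"
        by (simp add: W_def Wbar_def node_Suc y_def algebra_simps)
      from mult_left_mono[OF this \<open>c \<ge> 0\<close>] have "\<bar>r j t\<bar> \<le> c * (2 * B * h\<^sup>2)"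
        using \<open>c \<ge> 0\<close> by (simp add: r_def abs_mult)
      also have "\<dots> = 2 * lam * B * h"
        using h by (simp add: c_def power2_eq_square)
      finally show ?thesis .
    qed
    have T0: "0 \<in> {0..T}"
      using \<open>T > 0\<close> by simp
    have e0: "e j 0 = 0" for j
    proof (rule periodic_eq_on_period[where f = "\<lambda>j. e j 0", OF _ \<open>N > 0\<close>])
      show "e i 0 = 0" if "i \<in> {0..<int N}" for i
        using init that exact[OF node_in(1)[OF that] T0]
        by (simp add: exact_initial_data_def e_def W_def)
    qed (rule e_per(1)[OF T0])
    have g0: "g j 0 = 0" for j
    proof (rule periodic_eq_on_period[where f = "\<lambda>j. g j 0", OF _ \<open>N > 0\<close>])
      show "g i 0 = 0" if "i \<in> {0..<int N}" for i
        using init that Wbar[OF that T0] by (simp add: exact_initial_data_def g_def)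
    qed (rule e_per(2)[OF T0])
    have "(\<Sum>j\<in>{0..<int N}. (e j T)\<^sup>2 + (g j T)\<^sup>2)
        \<le> 12 * real N * (2 * lam * B * h)\<^sup>2 * T * exp (6 * T)"
    proof (rule hybrid_variable_stability[where c = c and r = r and e = e and g = g])
      fix j t
      assume t: "t \<in> {0..T}"
      show "(g j has_real_derivative - c * (e (j + 1) t - e j t)) (at t within {0..T})"
        unfolding g_def e_def
        by (rule DERIV_cong[OF DERIV_diff[OF wbar'[OF t] Wbar']]) (simp add: algebra_simps)
      have "c * h = lam"
        using h by (simp add: c_def)
      then show "(e j has_real_derivative
          - c * (e (j - 1) t - 7 / 2 * g (j - 1) t + 2 * e j t + 1 / 2 * g j t) + r j t)
          (at t within {0..T})"
        unfolding g_def e_def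
        by (intro DERIV_cong[OF DERIV_diff[OF w'[OF t] W']]) (simp add: r_def algebra_simps)
    next
      show "\<And>j t. t \<in> {0..T} \<Longrightarrow> e (j + int N) t = e j t"
        "\<And>j t. t \<in> {0..T} \<Longrightarrow> g (j + int N) t = g j t"
        by (fact e_per)+
    qed (use r_le e0 g0 \<open>c \<ge> 0\<close> \<open>T > 0\<close> in \<open>simp_all\<close>)
    also have "\<dots> = K / real N"
      using \<open>N > 0\<close> by (simp add: K_def h_def power2_eq_square field_simps)
    also have "\<dots> \<le> eps0\<^sup>2"
    proof -
      have "K / eps0\<^sup>2 \<le> real N"
        using N0 \<open>N > N0\<close> by simp
      then show ?thesis
        using \<open>N > 0\<close> \<open>eps0 > 0\<close> by (simp add: field_simps)
    qed
    finally have total: "(\<Sum>j\<in>{0..<int N}. (e j T)\<^sup>2 + (g j T)\<^sup>2) \<le> eps0\<^sup>2" .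
    show "\<forall>j\<in>{0..<int N}. \<bar>w j T - wstar (node L N j) T\<bar> \<le> eps0
        \<and> \<bar>wbar j T - cell_average L N j (\<lambda>x. wstar x T)\<bar> \<le> eps0"
    proof
      fix j assume j: "j \<in> {0..<int N}"
      have "(e j T)\<^sup>2 + (g j T)\<^sup>2 \<le> (\<Sum>j\<in>{0..<int N}. (e j T)\<^sup>2 + (g j T)\<^sup>2)"
        using j by (intro member_le_sum) auto
      with total have "(e j T)\<^sup>2 + (g j T)\<^sup>2 \<le> eps0\<^sup>2"
        by simp
      then have "(e j T)\<^sup>2 \<le> eps0\<^sup>2" "(g j T)\<^sup>2 \<le> eps0\<^sup>2"
        using zero_le_power2[of "e j T"] zero_le_power2[of "g j T"] by linarith+
      then have "\<bar>e j T\<bar> \<le> eps0" "\<bar>g j T\<bar> \<le> eps0"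
        using \<open>eps0 > 0\<close> by (auto simp: abs_le_square_iff[symmetric])
      moreover have "w j T - wstar (node L N j) T = e j T"
        using exact node_in(1)[OF j] \<open>T > 0\<close> by (simp add: e_def W_def)
      moreover have "wbar j T - cell_average L N j (\<lambda>x. wstar x T) = g j T"
        using Wbar[OF j] \<open>T > 0\<close> by (simp add: g_def)
      ultimately show "\<bar>w j T - wstar (node L N j) T\<bar> \<le> eps0
          \<and> \<bar>wbar j T - cell_average L N j (\<lambda>x. wstar x T)\<bar> \<le> eps0"
        by simp
    qed
  qed
qed

end
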